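(* Let $N=\{1,2,\ldots,n\}$ be a finite set of players and let $\Sigma$ be a set of strategies with $|\Sigma|=n$. Let $v:N\times N\to\mathbb{R}$ satisfy $v(i,j)=v(j,i)$ for all $i,j\in N$ and $v(i,i)=0$ for all $i\in N$. For a strategy tuple $\bm{\sigma}=(\sigma_1,\ldots,\sigma_n)\in\Sigma^n$, let $S_{\bm{\sigma}}(i)=\{j\in N:\sigma_j=\sigma_i\}$, let $\Pi(\bm{\sigma})=\{S_{\bm{\sigma}}(i): i\in N\}$ be the induced partition of $N$, and let the gain of player $i$ be the additively separable and symmetric gain $$\phi_i(\bm{\sigma})=\sum_{j\in S_{\bm{\sigma}}(i)} v(i,j).$$ Then the non-cooperative game with player set $N$, common strategy set $\Sigma$ and gains $(\phi_i)_{i\in N}$ is a potential game with potential function $$P_{\mathbf{v}}(\bm{\sigma})=\sum_{S\in\Pi(\bm{\sigma})}\ \sum_{(i,j)\in\mathcal{V}(S)} v(i,j),$$ where $\mathcal{V}(S)=\{(i,j)\in S\times S: j>i\}$.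
   Context: Players choosing the same strategy are interpreted as forming a coalition, so each strategy tuple $\bm{\sigma}$ induces a partition $\Pi(\bm{\sigma})$ of $N$ (a set of coalitions, each counted once). The number $v(i,j)$ is the mutual gain of players $i$ and $j$ when they are in the same coalition; gains are additively separable (a player's gain in a coalition $S$ is $\sum_{j\in S}v(i,j)$) and symmetric ($v(i,j)=v(j,i)$), with the normalization $v(i,i)=0$. $\mathcal{V}(S)$ is the set of unordered pairs of distinct players of $S$, each listed once with the smaller index first; for $|S|=1$ it is empty and the corresponding sum is $0$. A non-cooperative game with gains $(\phi_i)_{i\in N}$ on $\Sigma^n$ is a potential game with potential function $P:\Sigma^n\to\mathbb{R}$ if for every player $i\in N$, all strategies $\sigma_i,\sigma_i'\in\Sigma$, and every tuple $\sigma_{-i}$ of strategies of the players other than $i$, $$P(\sigma_i,\sigma_{-i})-P(\sigma_i',\sigma_{-i})=\phi_i(\sigma_i,\sigma_{-i})-\phi_i(\sigma_i',\sigma_{-i}).$$ *)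

theory Defs
  imports Complex_Main "HOL-Library.FuncSet"
begin

text \<open>
  Strategy tuples in \<open>\<Sigma>\<^sup>N\<close> are extensional functions \<open>N \<rightarrow>\<^sub>E \<Sigma>\<close>. A tuple of strategies of the
  players other than \<open>i\<close> is an element \<open>\<tau>\<close> of \<open>(N - {i}) \<rightarrow>\<^sub>E \<Sigma>\<close>, and \<open>\<tau>(i := s)\<close> is the full
  tuple in which player \<open>i\<close> plays \<open>s\<close>.
\<close>

definition potential_game_with ::
  "'p set \<Rightarrow> 's set \<Rightarrow> ('p \<Rightarrow> ('p \<Rightarrow> 's) \<Rightarrow> real) \<Rightarrow> (('p \<Rightarrow> 's) \<Rightarrow> real) \<Rightarrow> bool" where
  "potential_game_with N \<Sigma> \<phi> P \<longleftrightarrow>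
     (\<forall>i\<in>N. \<forall>s\<in>\<Sigma>. \<forall>s'\<in>\<Sigma>. \<forall>\<tau> \<in> (N - {i}) \<rightarrow>\<^sub>E \<Sigma>.
        P (\<tau>(i := s)) - P (\<tau>(i := s')) = \<phi> i (\<tau>(i := s)) - \<phi> i (\<tau>(i := s')))"

definition coalition :: "'p set \<Rightarrow> ('p \<Rightarrow> 's) \<Rightarrow> 'p \<Rightarrow> 'p set" where
  "coalition N \<sigma> i = {j \<in> N. \<sigma> j = \<sigma> i}"

definition induced_partition :: "'p set \<Rightarrow> ('p \<Rightarrow> 's) \<Rightarrow> 'p set set" where
  "induced_partition N \<sigma> = {coalition N \<sigma> i | i. i \<in> N}"

definition gain :: "'p set \<Rightarrow> ('p \<Rightarrow> 'p \<Rightarrow> real) \<Rightarrow> 'p \<Rightarrow> ('p \<Rightarrow> 's) \<Rightarrow> real" where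
  "gain N v i \<sigma> = (\<Sum>j\<in>coalition N \<sigma> i. v i j)"

definition ordered_pairs :: "'p::linorder set \<Rightarrow> ('p \<times> 'p) set" where
  "ordered_pairs S = {(i, j) \<in> S \<times> S. j > i}"

definition coalition_potential ::
  "'p::linorder set \<Rightarrow> ('p \<Rightarrow> 'p \<Rightarrow> real) \<Rightarrow> ('p \<Rightarrow> 's) \<Rightarrow> real" where
  "coalition_potential N v \<sigma> = (\<Sum>S\<in>induced_partition N \<sigma>. \<Sum>(i, j)\<in>ordered_pairs S. v i j)"

end

(* The potential is the sum of v over all pairs a < b playing the same strategy. The pairs
   containing player i contribute, by symmetry, exactly the gain of i, and the remaining pairs
   form the potential of N - {i}, which does not see the strategy of i. *)
theory Submission
  imports Defs
begin

text \<open>The coalitions are the fibres of \<open>\<sigma>\<close> on \<open>N\<close>, so a pair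
  with \<open>\<sigma> a = \<sigma> b\<close> lies in exactly one of them. The double sum thus
  becomes a single sum in which the partition no longer appears.\<close>

lemma coalition_potential_eq_sum_pairs:
  assumes "finite N"
  shows "coalition_potential N v \<sigma> = (\<Sum>(a, b)\<in>{(a, b) \<in> ordered_pairs N. \<sigma> a = \<sigma> b}. v a b)"
proof -
  have "finite (induced_partition N \<sigma>)"
    using assms by (simp add: induced_partition_def)
  moreover have "finite (ordered_pairs S)" if "S \<in> induced_partition N \<sigma>" for S
  proof (rule finite_subset)
    show "ordered_pairs S \<subseteq> N \<times> N"
      using that by (auto simp: induced_partition_def coalition_def ordered_pairs_def)
  qed (use assms in simp)
  \<comment> \<open>Two coalitions with a common player share that player's strategy and hence
    coincide.\<close>
  moreover have "ordered_pairs S \<inter> ordered_pairs T = {}"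
    if "S \<in> induced_partition N \<sigma>" "T \<in> induced_partition N \<sigma>" "S \<noteq> T" for S T
    using that by (auto simp: induced_partition_def coalition_def ordered_pairs_def)
  ultimately have "coalition_potential N v \<sigma>
      = (\<Sum>(a, b)\<in>(\<Union>S\<in>induced_partition N \<sigma>. ordered_pairs S). v a b)"
    unfolding coalition_potential_def by (subst sum.UNION_disjoint) auto
  also have "(\<Union>S\<in>induced_partition N \<sigma>. ordered_pairs S)
      = {(a, b) \<in> ordered_pairs N. \<sigma> a = \<sigma> b}"
  proof (intro equalityI subsetI)
    fix p assume "p \<in> {(a, b) \<in> ordered_pairs N. \<sigma> a = \<sigma> b}"
    then have "fst p \<in> N" "p \<in> ordered_pairs (coalition N \<sigma> (fst p))"
      by (auto simp: ordered_pairs_def coalition_def)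
    then show "p \<in> (\<Union>S\<in>induced_partition N \<sigma>. ordered_pairs S)"
      by (auto simp: induced_partition_def)
  qed (auto simp: induced_partition_def coalition_def ordered_pairs_def)
  finally show ?thesis .
qed

lemma coalition_potential_remove_player:
  assumes "finite N" "i \<in> N"
    and sym: "\<And>j. j \<in> N \<Longrightarrow> v i j = v j i" and diag: "v i i = 0"
  shows "coalition_potential N v \<sigma> = coalition_potential (N - {i}) v \<sigma> + gain N v i \<sigma>"
proof -
  let ?pairs = "\<lambda>M. {(a, b) \<in> ordered_pairs M. \<sigma> a = \<sigma> b}"
  define C where "C = coalition N \<sigma> i"
  \<comment> \<open>Pairs are listed with the smaller index first, so \<open>i\<close> is the first
    entry when its partner lies in \<open>U\<close> and the second when it lies in
    \<open>L\<close>.\<close>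
  define U where "U = {j \<in> C. i < j}"
  define L where "L = {j \<in> C. j < i}"
  have fin: "finite C" "finite U" "finite L"
    using assms(1) by (auto simp: C_def U_def L_def coalition_def)
  have finp: "finite (?pairs (N - {i}))"
    by (rule finite_subset[of _ "N \<times> N"]) (use assms(1) in \<open>auto simp: ordered_pairs_def\<close>)
  have split: "?pairs N = ?pairs (N - {i}) \<union> (Pair i ` U \<union> (\<lambda>a. (a, i)) ` L)"
    using \<open>i \<in> N\<close> by (auto simp: ordered_pairs_def U_def L_def C_def coalition_def)
  have "(\<Sum>(a, b)\<in>?pairs N. v a b) = (\<Sum>(a, b)\<in>?pairs (N - {i}). v a b)
      + ((\<Sum>(a, b)\<in>Pair i ` U. v a b) + (\<Sum>(a, b)\<in>(\<lambda>a. (a, i)) ` L. v a b))"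
    \<comment> \<open>The three parts are disjoint: the first avoids \<open>i\<close>, and the other
      two are told apart by the position of \<open>i\<close>.\<close>
    unfolding split using fin finp
    by (subst sum.union_disjoint; (subst sum.union_disjoint)?)
      (auto simp: ordered_pairs_def U_def L_def)
  also have "(\<Sum>(a, b)\<in>Pair i ` U. v a b) = (\<Sum>j\<in>U. v i j)"
    by (subst sum.reindex) (auto simp: inj_on_def)
  \<comment> \<open>Symmetry enters here: the pairs \<open>(a, i)\<close> carry
    \<open>v a i\<close>, while the gain of \<open>i\<close> counts \<open>v i a\<close>.\<close>
  also have "(\<Sum>(a, b)\<in>(\<lambda>a. (a, i)) ` L. v a b) = (\<Sum>j\<in>L. v i j)"
    by (subst sum.reindex) (auto simp: inj_on_def sym L_def C_def coalition_def)
  also have "(\<Sum>j\<in>U. v i j) + (\<Sum>j\<in>L. v i j) = (\<Sum>j\<in>U \<union> L. v i j)"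
    using fin by (subst sum.union_disjoint) (auto simp: U_def L_def)
  \<comment> \<open>The coalition of \<open>i\<close> also contains \<open>i\<close> itself, whose
    term is \<open>v i i = 0\<close>.\<close>
  also have "\<dots> = (\<Sum>j\<in>C. v i j)"
  proof (rule sum.mono_neutral_left)
    show "\<forall>j\<in>C - (U \<union> L). v i j = 0"
      using diag by (auto simp: U_def L_def not_less_iff_gr_or_eq)
  qed (use fin in \<open>auto simp: U_def L_def\<close>)
  finally show ?thesis
    using assms(1) by (simp add: coalition_potential_eq_sum_pairs gain_def C_def)
qed

text \<open>Coalitions within \<open>N\<close> compare only strategies of members of
  \<open>N\<close>. Used with player \<open>i\<close> removed, this makes the remainder term
  independent of the strategy of \<open>i\<close>.\<close>

lemma coalition_potential_fun_upd:
  assumes "i \<notin> N"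
  shows "coalition_potential N v (\<tau>(i := s)) = coalition_potential N v \<tau>"
proof -
  have "coalition N (\<tau>(i := s)) j = coalition N \<tau> j" if "j \<in> N" for j
    using assms that by (auto simp: coalition_def)
  then have "induced_partition N (\<tau>(i := s)) = induced_partition N \<tau>"
    by (force simp: induced_partition_def)
  then show ?thesis
    by (simp add: coalition_potential_def)
qed

theorem theorem5p1:
  fixes n :: nat
    and \<Sigma> :: "'s set"
    and v :: "nat \<Rightarrow> nat \<Rightarrow> real"
  assumes "finite \<Sigma>" and "card \<Sigma> = n"
    and "\<And>i j. i \<in> {1..n} \<Longrightarrow> j \<in> {1..n} \<Longrightarrow> v i j = v j i"
    and "\<And>i. i \<in> {1..n} \<Longrightarrow> v i i = 0"
  shows "potential_game_with {1..n} \<Sigma> (gain {1..n} v) (coalition_potential {1..n} v)"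
  unfolding potential_game_with_def
proof (intro ballI)
  fix i s s' \<tau>
  assume i: "i \<in> {1..n}"
  \<comment> \<open>The first summand is free of \<open>t\<close>, so it cancels when the instances
    for \<open>s\<close> and \<open>s'\<close> are subtracted.\<close>
  have "coalition_potential {1..n} v (\<tau>(i := t))
      = coalition_potential ({1..n} - {i}) v \<tau> + gain {1..n} v i (\<tau>(i := t))" for t
    using coalition_potential_remove_player[of "{1..n}" i v "\<tau>(i := t)"] assms(3,4) i
    by (simp add: coalition_potential_fun_upd)
  then show "coalition_potential {1..n} v (\<tau>(i := s)) - coalition_potential {1..n} v (\<tau>(i := s'))
      = gain {1..n} v i (\<tau>(i := s)) - gain {1..n} v i (\<tau>(i := s'))"
    by simp
qed

end
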